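(* Every computable physical model with finitely many observable quantities is determined by some partial recursive function $\phi$.
   Context: A computable physical model is a pair $(S,A)$ where $S$ is a recursive set of non-negative integers (states) and $A$ is a set of total recursive functions from the non-negative integers to the non-negative integers (observable quantities). Two models $(S,A)$ and $(T,B)$ (pairs of a set of non-negative integers and a set of partial functions on the non-negative integers) are isomorphic iff there exist bijections $\phi:S\to T$ and $\psi:A\to B$ with $\alpha(s)=\psi(\alpha)(\phi(s))$ for all $s\in S$, $\alpha\in A$. Sequences are coded via Cantor's pairing function $\langle x,y\rangle=\frac12(x^2+2xy+y^2+3x+y)$, $\langle x_1,\dots,x_n\rangle=\langle\langle x_1,\dots,x_{n-1}\rangle,x_n\rangle$, and $\pi_i^n\langle x_1,\dots,x_n\rangle=x_i$. Given a partial recursive function $\phi$, let $S$ be the largest set of consecutive non-negative integers beginning with $0$ such that $\phi(s)$ is defined for each $s\in S$, and let $A=\{\pi_1^m\circ\phi,\dots,\pi_m^m\circ\phi\}$ for some non-negative integer $m$; such an $(S,A)$ is isomorphic to a computable physical model, and any computable physical model isomorphic to such an $(S,A)$ is said to be determined by $\phi$.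
   Formalization: Observable quantities of (S,A) are compared as functions on S: members of A agreeing on all of S count as one. Without this the claim fails, e.g. for S the even numbers and A the zero function together with the characteristic function of the odd numbers. *)

theory Defs
  imports "HOL-Library.Nat_Bijection"
begin

section \<open>Partial recursive functions\<close>

datatype recf =
    Zero
  | Succ
  | Proj nat
  | Comp recf "recf list"
  | Prec recf recf
  | Mu recf

text \<open>
  Terms carry no arity: on argument lists of one fixed length, each term denotes one partial
  function. Minimisation is the usual one, requiring the function to be defined below the zero found.
\<close>

fun eval :: "recf \<Rightarrow> nat list \<Rightarrow> nat option" where
  "eval Zero xs = Some 0"
| "eval Succ xs = (case xs of [x] \<Rightarrow> Some (Suc x) | _ \<Rightarrow> None)"
| "eval (Proj i) xs = (if i < length xs then Some (xs ! i) else None)"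
| "eval (Comp f gs) xs =
     (if \<forall>g\<in>set gs. eval g xs \<noteq> None then eval f (map (\<lambda>g. the (eval g xs)) gs) else None)"
| "eval (Prec f g) xs =
     (case xs of
        [] \<Rightarrow> None
      | n # ys \<Rightarrow> rec_nat (eval f ys) (\<lambda>k r. Option.bind r (\<lambda>v. eval g (k # v # ys))) n)"
| "eval (Mu f) xs =
     (if \<exists>n. eval f (n # xs) = Some 0 \<and> (\<forall>k<n. eval f (k # xs) \<noteq> None)
      then Some (LEAST n. eval f (n # xs) = Some 0) else None)"

definition partial_recursive :: "(nat \<rightharpoonup> nat) \<Rightarrow> bool" where
  "partial_recursive \<phi> \<longleftrightarrow> (\<exists>r. \<forall>x. \<phi> x = eval r [x])"

definition total_recursive :: "(nat \<Rightarrow> nat) \<Rightarrow> bool" where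
  "total_recursive f \<longleftrightarrow> partial_recursive (\<lambda>x. Some (f x))"

definition recursive_set :: "nat set \<Rightarrow> bool" where
  "recursive_set S \<longleftrightarrow> total_recursive (\<lambda>x. if x \<in> S then 1 else 0)"


section \<open>Coding of sequences\<close>

lemma prod_encode_eq_Cantor: "prod_encode (x, y) = (x\<^sup>2 + 2 * x * y + y\<^sup>2 + 3 * x + y) div 2"
proof -
  have "x\<^sup>2 + 2 * x * y + y\<^sup>2 + 3 * x + y = (x + y) * Suc (x + y) + x * 2"
    by (simp add: power2_eq_square algebra_simps)
  then show ?thesis
    by (simp add: prod_encode_def triangle_def)
qed

text \<open>Only meant for nonempty lists; the code of a one-element list is its element.\<close>

definition tuple :: "nat list \<Rightarrow> nat" where
  "tuple xs = foldl (\<lambda>x y. prod_encode (x, y)) (hd xs) (tl xs)"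

text \<open>
  \<open>component m i\<close> is $\pi^m_i$, with $1 \le i \le m$; the values for other arguments are never used.
  It is determined by its action on tuples: see \<open>component_tuple\<close> and \<open>ex_tuple\<close>.
\<close>

fun component :: "nat \<Rightarrow> nat \<Rightarrow> nat \<Rightarrow> nat" where
  "component 0 i z = z"
| "component (Suc 0) i z = z"
| "component (Suc (Suc n)) i z =
     (if i = Suc (Suc n) then snd (prod_decode z) else component (Suc n) i (fst (prod_decode z)))"

lemma tuple_singleton: "tuple [x] = x"
  by (simp add: tuple_def)

lemma tuple_snoc: "xs \<noteq> [] \<Longrightarrow> tuple (xs @ [x]) = prod_encode (tuple xs, x)"
  by (cases xs) (simp_all add: tuple_def)

lemma component_tuple:
  "1 \<le> i \<Longrightarrow> i \<le> length xs \<Longrightarrow> component (length xs) i (tuple xs) = xs ! (i - 1)"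
proof (induction xs rule: rev_induct)
  case Nil
  then show ?case by simp
next
  case (snoc x xs)
  show ?case
  proof (cases xs)
    case Nil
    then show ?thesis using snoc.prems by (simp add: tuple_singleton)
  next
    case (Cons a as)
    then have "component (length (xs @ [x])) i (tuple (xs @ [x])) =
      (if i = Suc (length xs) then x else component (length xs) i (tuple xs))"
      by (simp add: tuple_snoc del: append_Cons)
    then show ?thesis using snoc by (auto simp: nth_append)
  qed
qed

lemma ex_tuple: "1 \<le> m \<Longrightarrow> \<exists>xs. length xs = m \<and> tuple xs = z"
proof (induction m arbitrary: z rule: dec_induct)
  case base
  show ?case by (rule exI[of _ "[z]"]) (simp add: tuple_singleton)
next
  case (step m)
  obtain a b where ab: "z = prod_encode (a, b)"
    by (metis prod_decode_inverse surj_pair)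
  obtain xs where "length xs = m" "tuple xs = a"
    using step.IH by blast
  then show ?case
    using step.hyps ab tuple_snoc[of xs b] by (intro exI[of _ "xs @ [b]"]) fastforce
qed


section \<open>Physical models\<close>

definition computable_physical_model :: "nat set \<times> (nat \<Rightarrow> nat) set \<Rightarrow> bool" where
  "computable_physical_model = (\<lambda>(S, A). recursive_set S \<and> (\<forall>\<alpha>\<in>A. total_recursive \<alpha>))"

definition isomorphic ::
  "nat set \<times> (nat \<rightharpoonup> nat) set \<Rightarrow> nat set \<times> (nat \<rightharpoonup> nat) set \<Rightarrow> bool" where
  "isomorphic = (\<lambda>(S, A) (T, B).
     \<exists>\<phi> \<psi>. bij_betw \<phi> S T \<and> bij_betw \<psi> A B \<and> (\<forall>s\<in>S. \<forall>\<alpha>\<in>A. \<alpha> s = \<psi> \<alpha> (\<phi> s)))"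

text \<open>
  Convention: the observable quantities of a computable physical model are compared as functions on
  its set of states, so two total functions that agree on all states count as one observable
  quantity. This cannot be dropped. If \<open>S\<close> is the set of even numbers and \<open>A\<close> consists of
  the zero function and the characteristic function of the odd numbers, then a bijection from
  \<open>A\<close> itself would require two distinct observables that both vanish on the state set of the
  determining function; that state set is infinite, hence all of the natural numbers, so the two
  would coincide. If distinct members of \<open>A\<close> already differ on \<open>S\<close>, the restriction is a
  bijection and changes nothing.
\<close>

definition on_states :: "nat set \<times> (nat \<Rightarrow> nat) set \<Rightarrow> nat set \<times> (nat \<rightharpoonup> nat) set" where
  "on_states = (\<lambda>(S, A). (S, (\<lambda>\<alpha>. (Some \<circ> \<alpha>) |` S) ` A))"

definition states :: "(nat \<rightharpoonup> nat) \<Rightarrow> nat set" where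
  "states \<phi> = {s. {0..s} \<subseteq> dom \<phi>}"

lemma states_greatest:
  "states \<phi> \<subseteq> dom \<phi>"
  "s \<in> states \<phi> \<Longrightarrow> t \<le> s \<Longrightarrow> t \<in> states \<phi>"
  "I \<subseteq> dom \<phi> \<Longrightarrow> (\<And>s t. s \<in> I \<Longrightarrow> t \<le> s \<Longrightarrow> t \<in> I) \<Longrightarrow> I \<subseteq> states \<phi>"
proof -
  show "states \<phi> \<subseteq> dom \<phi>"
    by (auto simp: states_def)
  show "s \<in> states \<phi> \<Longrightarrow> t \<le> s \<Longrightarrow> t \<in> states \<phi>"
    by (auto simp: states_def subset_iff)
  show "I \<subseteq> dom \<phi> \<Longrightarrow> (\<And>s t. s \<in> I \<Longrightarrow> t \<le> s \<Longrightarrow> t \<in> I) \<Longrightarrow> I \<subseteq> states \<phi>"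
    unfolding states_def by (metis (mono_tags, lifting) atLeastAtMost_iff mem_Collect_eq subset_iff)
qed

definition observables :: "nat \<Rightarrow> (nat \<rightharpoonup> nat) \<Rightarrow> (nat \<rightharpoonup> nat) set" where
  "observables m \<phi> = (\<lambda>i. map_option (component m i) \<circ> \<phi>) ` {1..m}"

definition determined_by :: "nat set \<times> (nat \<Rightarrow> nat) set \<Rightarrow> (nat \<rightharpoonup> nat) \<Rightarrow> bool" where
  "determined_by M \<phi> \<longleftrightarrow>
     computable_physical_model M \<and>
     (\<exists>m. isomorphic (on_states M) (states \<phi>, observables m \<phi>))"

end

theory Submission imports Defs begin

text \<open>
  Since \<open>S\<close> is recursive, so is its rank function \<open>s \<mapsto> card (S \<inter> {..<s})\<close>, and unbounded search
  for the least \<open>s\<close> such that \<open>S\<close> has more than \<open>n\<close> elements in \<open>{..s}\<close> is a partial recursive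
  function sending \<open>n\<close> to the \<open>n\<close>-th element of \<open>S\<close>. Its domain is an initial segment of the
  naturals, finite or not according to \<open>S\<close>, and it inverts the rank function on \<open>S\<close>. Composing it
  with \<open>s \<mapsto> \<langle>\<alpha>\<^sub>1 s, \<dots>, \<alpha>\<^sub>m s\<rangle>\<close>, where the \<open>\<alpha>\<^sub>i\<close> list \<open>A\<close>, gives a function determining \<open>(S, A)\<close>.
\<close>

section \<open>Recursive functions\<close>

definition recf_add :: recf where
  "recf_add = Prec (Proj 0) (Comp Succ [Proj 1])"

lemma eval_recf_add [simp]: "eval recf_add [x, y] = Some (x + y)"
  unfolding recf_add_def by (induction x) auto

definition recf_pred :: recf where
  "recf_pred = Prec Zero (Proj 0)"

lemma eval_recf_pred [simp]: "eval recf_pred [x] = Some (x - 1)"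
  unfolding recf_pred_def by (induction x) auto

text \<open>Primitive recursion runs on the first argument, so the subtrahend comes first.\<close>

definition recf_diff :: recf where
  "recf_diff = Prec (Proj 0) (Comp recf_pred [Proj 1])"

lemma eval_recf_diff [simp]: "eval recf_diff [x, y] = Some (y - x)"
  unfolding recf_diff_def by (induction x) auto

definition recf_triangle :: recf where
  "recf_triangle = Prec Zero (Comp recf_add [Comp Succ [Proj 0], Proj 1])"

lemma eval_recf_triangle [simp]: "eval recf_triangle [n] = Some (triangle n)"
  unfolding recf_triangle_def by (induction n) auto

definition recf_prod_encode :: recf where
  "recf_prod_encode = Comp recf_add [Comp recf_triangle [recf_add], Proj 0]"

lemma eval_recf_prod_encode [simp]: "eval recf_prod_encode [x, y] = Some (prod_encode (x, y))"
  unfolding recf_prod_encode_def by (simp add: prod_encode_def)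

lemma total_recursive_prod_encode:
  assumes "total_recursive f" "total_recursive g"
  shows "total_recursive (\<lambda>x. prod_encode (f x, g x))"
proof -
  obtain r t where "\<And>x. eval r [x] = Some (f x)" "\<And>x. eval t [x] = Some (g x)"
    using assms unfolding total_recursive_def partial_recursive_def by metis
  then have "eval (Comp recf_prod_encode [r, t]) [x] = Some (prod_encode (f x, g x))" for x
    by simp
  then show ?thesis
    unfolding total_recursive_def partial_recursive_def by metis
qed

lemma partial_recursive_map_option:
  assumes "total_recursive f" "partial_recursive e"
  shows "partial_recursive (map_option f \<circ> e)"
proof -
  obtain r t where "\<And>x. eval r [x] = Some (f x)" "\<And>x. eval t [x] = e x"
    using assms unfolding total_recursive_def partial_recursive_def by metis
  then have "eval (Comp r [t]) [x] = (map_option f \<circ> e) x" for x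
    by (cases "e x") auto
  then show ?thesis
    unfolding partial_recursive_def by metis
qed

text \<open>Induction appends at the right end because \<open>tuple\<close> nests to the
  left.\<close>

lemma total_recursive_tuple:
  assumes "\<alpha>s \<noteq> []" "\<forall>\<alpha>\<in>set \<alpha>s. total_recursive \<alpha>"
  shows "total_recursive (\<lambda>x. tuple (map (\<lambda>\<alpha>. \<alpha> x) \<alpha>s))"
  using assms
proof (induction \<alpha>s rule: rev_nonempty_induct)
  case (single \<alpha>)
  then show ?case by (simp add: tuple_singleton)
next
  case (snoc \<alpha> \<alpha>s)
  then show ?case
    by (simp add: tuple_snoc total_recursive_prod_encode)
qed

lemma ex_total_recursive_components:
  assumes "\<forall>\<alpha>\<in>set \<alpha>s. total_recursive \<alpha>"
  shows "\<exists>f. total_recursive f \<and>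
    (\<forall>i\<in>{1..length \<alpha>s}. component (length \<alpha>s) i \<circ> f = \<alpha>s ! (i - 1))"
proof (cases "\<alpha>s = []")
  case True
  \<comment> \<open>With no components to recover the condition is vacuous, and any total recursive
    function serves.\<close>
  have "total_recursive (\<lambda>x. 0)"
    unfolding total_recursive_def partial_recursive_def by (metis eval.simps(1))
  then show ?thesis using True by auto
next
  case False
  have "component (length \<alpha>s) i (tuple (map (\<lambda>\<alpha>. \<alpha> x) \<alpha>s)) = (\<alpha>s ! (i - 1)) x"
    if "i \<in> {1..length \<alpha>s}" for i x
    using that component_tuple[of i "map (\<lambda>\<alpha>. \<alpha> x) \<alpha>s"] by auto
  then show ?thesis
    using total_recursive_tuple[OF False assms] by (intro exI conjI ballI ext) auto
qed


section \<open>Enumerating a recursive set\<close>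

definition rank :: "nat set \<Rightarrow> nat \<Rightarrow> nat" where
  "rank S s = card (S \<inter> {..<s})"

lemma rank_0 [simp]: "rank S 0 = 0"
  by (simp add: rank_def)

lemma rank_Suc [simp]: "rank S (Suc s) = (if s \<in> S then Suc (rank S s) else rank S s)"
  by (simp add: rank_def lessThan_Suc)

lemma mono_rank: "s \<le> t \<Longrightarrow> rank S s \<le> rank S t"
  unfolding rank_def by (intro card_mono) auto

text \<open>\<open>rank S (Suc s)\<close> counts the elements of \<open>S\<close> up to and
  including \<open>s\<close>, so it first exceeds \<open>n\<close> at the element of rank
  \<open>n\<close>. The form as a least number matches \<open>Mu\<close>.\<close>

definition nth_element :: "nat set \<Rightarrow> nat \<rightharpoonup> nat" where
  "nth_element S n =
     (if \<exists>s. n < rank S (Suc s) then Some (LEAST s. n < rank S (Suc s)) else None)"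

lemma nth_element_eq_Some_iff: "nth_element S n = Some s \<longleftrightarrow> s \<in> S \<and> rank S s = n"
proof
  assume "nth_element S n = Some s"
  then have ex: "\<exists>s. n < rank S (Suc s)" and s: "s = (LEAST s. n < rank S (Suc s))"
    unfolding nth_element_def by (auto simp del: rank_Suc split: if_splits)
  have gt: "n < rank S (Suc s)"
    using ex unfolding s by (rule LeastI_ex)
  \<comment> \<open>By minimality the count before \<open>s\<close> is at most \<open>n\<close>. It
    exceeds \<open>n\<close> once \<open>s\<close> is included, so it jumps there.\<close>
  have "rank S s \<le> n"
  proof (cases s)
    case (Suc t)
    then have "\<not> n < rank S (Suc t)"
      using s by (metis lessI not_less_Least)
    then show ?thesis using Suc by (simp only: not_less)
  qed simp
  then show "s \<in> S \<and> rank S s = n"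
    using gt by (auto split: if_splits)
next
  assume s: "s \<in> S \<and> rank S s = n"
  have "(LEAST t. n < rank S (Suc t)) = s"
  proof (rule Least_equality)
    show "n < rank S (Suc s)" using s by simp
  next
    fix t assume "n < rank S (Suc t)"
    then show "s \<le> t" using s mono_rank[of "Suc t" s S] by linarith
  qed
  then show "nth_element S n = Some s"
    using s unfolding nth_element_def by (auto simp del: rank_Suc intro!: exI[of _ s]) simp
qed

lemma nth_element_rank: "s \<in> S \<Longrightarrow> nth_element S (rank S s) = Some s"
  by (simp add: nth_element_eq_Some_iff)

lemma dom_nth_element: "dom (nth_element S) = rank S ` S"
  by (auto simp: dom_def nth_element_eq_Some_iff)

text \<open>A witness \<open>s\<close> for \<open>n < rank S (Suc s)\<close> also serves every
  \<open>k \<le> n\<close>.\<close>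

lemma dom_nth_element_downward_closed:
  "n \<in> dom (nth_element S) \<Longrightarrow> k \<le> n \<Longrightarrow> k \<in> dom (nth_element S)"
  unfolding nth_element_def dom_def by (auto simp del: rank_Suc split: if_splits) (meson le_less_trans)

lemma partial_recursive_nth_element:
  assumes "recursive_set S"
  shows "partial_recursive (nth_element S)"
proof -
  obtain r where r: "\<And>x. eval r [x] = Some (if x \<in> S then 1 else 0)"
    using assms unfolding recursive_set_def total_recursive_def partial_recursive_def by metis
  define c where "c = Prec Zero (Comp recf_add [Comp r [Proj 0], Proj 1])"
  have c: "eval c [s] = Some (rank S s)" for s
    unfolding c_def by (induction s) (auto simp: r)
  \<comment> \<open>The truncated difference is 0 exactly when \<open>n < rank S (Suc s)\<close>. As
    it is defined everywhere, the search by \<open>Mu\<close> never meets an undefined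
    value.\<close>
  define p where "p = Comp recf_diff [Comp c [Comp Succ [Proj 0]], Comp Succ [Proj 1]]"
  have p: "eval p [s, n] = Some (Suc n - rank S (Suc s))" for s n
    unfolding p_def by (simp add: c del: rank_Suc)
  have "nth_element S n = eval (Mu p) [n]" for n
    unfolding nth_element_def by (simp add: p Suc_le_eq del: rank_Suc)
  then show ?thesis
    unfolding partial_recursive_def by metis
qed


section \<open>The determining function\<close>

lemma states_eq_dom:
  assumes "\<And>n k. n \<in> dom \<phi> \<Longrightarrow> k \<le> n \<Longrightarrow> k \<in> dom \<phi>"
  shows "states \<phi> = dom \<phi>"
proof
  show "states \<phi> \<subseteq> dom \<phi>" by (rule states_greatest(1))
  show "dom \<phi> \<subseteq> states \<phi>" using assms by (intro states_greatest(3)) auto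
qed

text \<open>States are relabelled by \<open>rank S\<close>, and observables are transported by
  precomposition with its inverse \<open>nth_element S\<close>, which takes values only in
  \<open>S\<close>.\<close>

lemma isomorphic_on_states_nth_element:
  "isomorphic (on_states (S, A)) (rank S ` S, (\<lambda>\<alpha>. map_option \<alpha> \<circ> nth_element S) ` A)"
proof -
  define \<psi> :: "(nat \<rightharpoonup> nat) \<Rightarrow> nat \<rightharpoonup> nat" where "\<psi> \<beta> = \<beta> \<circ>\<^sub>m nth_element S" for \<beta>
  have \<psi>_restrict: "\<psi> ((Some \<circ> \<alpha>) |` S) = map_option \<alpha> \<circ> nth_element S" for \<alpha>
  proof
    fix n show "\<psi> ((Some \<circ> \<alpha>) |` S) n = (map_option \<alpha> \<circ> nth_element S) n"
      by (cases "nth_element S n") (auto simp: \<psi>_def nth_element_eq_Some_iff nth_element_rank)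
  qed
  \<comment> \<open>This is the isomorphism equation, and it also makes \<open>\<psi>\<close>
    injective on maps that are \<open>None\<close> outside \<open>S\<close>.\<close>
  have \<psi>_rank: "\<psi> \<beta> (rank S s) = \<beta> s" if "s \<in> S" for \<beta> s
    using that by (simp add: \<psi>_def nth_element_rank)
  have "inj_on (rank S) S"
    by (rule inj_onI) (metis nth_element_rank option.inject)
  moreover have "inj_on \<psi> ((\<lambda>\<alpha>. (Some \<circ> \<alpha>) |` S) ` A)"
  proof (rule inj_onI, rule ext)
    fix \<beta> \<gamma> s
    assume "\<beta> \<in> (\<lambda>\<alpha>. (Some \<circ> \<alpha>) |` S) ` A" "\<gamma> \<in> (\<lambda>\<alpha>. (Some \<circ> \<alpha>) |` S) ` A" "\<psi> \<beta> = \<psi> \<gamma>"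
    then show "\<beta> s = \<gamma> s"
      by (cases "s \<in> S") (metis \<psi>_rank, auto simp: restrict_map_def)
  qed
  moreover have "\<psi> ` (\<lambda>\<alpha>. (Some \<circ> \<alpha>) |` S) ` A = (\<lambda>\<alpha>. map_option \<alpha> \<circ> nth_element S) ` A"
    by (simp add: image_image \<psi>_restrict)
  ultimately show ?thesis
    unfolding isomorphic_def on_states_def bij_betw_def
    by (auto simp: \<psi>_rank intro!: exI[of _ "rank S"] exI[of _ \<psi>])
qed

theorem theorem4:
  fixes S :: "nat set" and A :: "(nat \<Rightarrow> nat) set"
  assumes "computable_physical_model (S, A)" and "finite A"
  shows "\<exists>\<phi>. partial_recursive \<phi> \<and> determined_by (S, A) \<phi>"
proof -
  have S: "recursive_set S" and A: "\<forall>\<alpha>\<in>A. total_recursive \<alpha>"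
    using assms(1) by (auto simp: computable_physical_model_def)
  \<comment> \<open>The list may repeat members of \<open>A\<close>; this is harmless because
    \<open>observables\<close> forms a set.\<close>
  obtain \<alpha>s where \<alpha>s: "set \<alpha>s = A"
    using finite_list[OF assms(2)] by blast
  define m where "m = length \<alpha>s"
  obtain f where f: "total_recursive f" "\<And>i. i \<in> {1..m} \<Longrightarrow> component m i \<circ> f = \<alpha>s ! (i - 1)"
    using ex_total_recursive_components[of \<alpha>s] A \<alpha>s unfolding m_def by blast
  define \<phi> where "\<phi> = map_option f \<circ> nth_element S"
  have dom: "dom \<phi> = dom (nth_element S)"
    unfolding \<phi>_def by (auto simp: dom_def)
  have states: "states \<phi> = rank S ` S"
    using states_eq_dom[of \<phi>] dom_nth_element_downward_closed[of _ S] dom_nth_element[of S]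
    unfolding dom by blast
  have "observables m \<phi> = (\<lambda>i. map_option (\<alpha>s ! (i - 1)) \<circ> nth_element S) ` {1..m}"
    unfolding observables_def \<phi>_def
    by (intro image_cong refl) (simp only: f(2)[symmetric] fun_eq_iff o_apply option.map_comp simp_thms)
  \<comment> \<open>Components are numbered from 1 and list positions from 0, hence the shift by
    \<open>Suc\<close>.\<close>
  also have "\<dots> = (\<lambda>\<alpha>. map_option \<alpha> \<circ> nth_element S) ` (\<lambda>i. \<alpha>s ! (i - 1)) ` Suc ` {..<m}"
    by (simp only: image_image image_Suc_lessThan)
  also have "(\<lambda>i. \<alpha>s ! (i - 1)) ` Suc ` {..<m} = A"
    unfolding \<alpha>s[symmetric] m_def by (auto simp: set_conv_nth image_image)
  finally have "isomorphic (on_states (S, A)) (states \<phi>, observables m \<phi>)"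
    using isomorphic_on_states_nth_element[of S A] states by (simp only:)
  moreover have "partial_recursive \<phi>"
    unfolding \<phi>_def using f(1) partial_recursive_nth_element[OF S]
    by (rule partial_recursive_map_option)
  ultimately show ?thesis
    using assms(1) unfolding determined_by_def by blast
qed

end
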